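(* A topological vector space $E$ (over $\mathbb{R}$ or $\mathbb{C}$) is $p$-normed for some $0<p\le1$ if and only if $E$ is Fréchet–Urysohn and admits a fundamental sequence of bounded sets.
   Context: A tvs is $p$-normed if its topology is generated by a $p$-norm, i.e. a map $\|\cdot\|:E\to[0,\infty)$ with $\|x\|=0$ iff $x=0$, $\|\lambda x\|=|\lambda|^p\|x\|$ and $\|x+y\|\le\|x\|+\|y\|$. A fundamental sequence of bounded sets is a sequence $(B_n)$ of bounded subsets of $E$ such that every bounded subset of $E$ is contained in some $B_n$. A space is Fréchet–Urysohn if whenever $x\in\overline{A}$ there is a sequence in $A$ converging to $x$.
   Formalization: Topological vector spaces are assumed Hausdorff; without this the claim fails, e.g. for the real line with the indiscrete topology, which is Fréchet–Urysohn with a fundamental sequence of bounded sets but is not p-normed. *)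

theory Defs
  imports "HOL-Analysis.Analysis"
begin

definition tvs :: "('k::real_normed_field \<Rightarrow> 'a::ab_group_add \<Rightarrow> 'a) \<Rightarrow> 'a topology \<Rightarrow> bool" where
  "tvs smul T \<longleftrightarrow>
     vector_space smul \<and> topspace T = UNIV \<and> Hausdorff_space T \<and>
     continuous_map (prod_topology T T) T (\<lambda>(x, y). x + y) \<and>
     continuous_map (prod_topology euclidean T) T (\<lambda>(c, x). smul c x)"

definition tvs_bounded :: "('k::real_normed_field \<Rightarrow> 'a::ab_group_add \<Rightarrow> 'a) \<Rightarrow> 'a topology \<Rightarrow> 'a set \<Rightarrow> bool" where
  "tvs_bounded smul T B \<longleftrightarrow>
     (\<forall>U. openin T U \<and> 0 \<in> U \<longrightarrow>
        (\<exists>s>0. \<forall>t. norm t > s \<longrightarrow> B \<subseteq> smul t ` U))"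

definition has_fundamental_bounded_seq :: "('k::real_normed_field \<Rightarrow> 'a::ab_group_add \<Rightarrow> 'a) \<Rightarrow> 'a topology \<Rightarrow> bool" where
  "has_fundamental_bounded_seq smul T \<longleftrightarrow>
     (\<exists>Bs :: nat \<Rightarrow> 'a set. (\<forall>n. tvs_bounded smul T (Bs n)) \<and>
        (\<forall>B. tvs_bounded smul T B \<longrightarrow> (\<exists>n. B \<subseteq> Bs n)))"

definition frechet_urysohn :: "'a topology \<Rightarrow> bool" where
  "frechet_urysohn T \<longleftrightarrow>
     (\<forall>A x. x \<in> T closure_of A \<longrightarrow>
        (\<exists>s :: nat \<Rightarrow> 'a. (\<forall>n. s n \<in> A) \<and> limitin T s x sequentially))"

definition is_p_norm :: "('k::real_normed_field \<Rightarrow> 'a::ab_group_add \<Rightarrow> 'a) \<Rightarrow> real \<Rightarrow> ('a \<Rightarrow> real) \<Rightarrow> bool" where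
  "is_p_norm smul p N \<longleftrightarrow>
     (\<forall>x. N x \<ge> 0) \<and> (\<forall>x. N x = 0 \<longleftrightarrow> x = 0) \<and>
     (\<forall>c x. N (smul c x) = norm c powr p * N x) \<and>
     (\<forall>x y. N (x + y) \<le> N x + N y)"

definition p_norm_generates :: "('a::ab_group_add \<Rightarrow> real) \<Rightarrow> 'a topology \<Rightarrow> bool" where
  "p_norm_generates N T \<longleftrightarrow>
     (\<forall>U. openin T U \<longleftrightarrow> (\<forall>x\<in>U. \<exists>r>0. {y. N (y - x) < r} \<subseteq> U))"

definition p_normed :: "('k::real_normed_field \<Rightarrow> 'a::ab_group_add \<Rightarrow> 'a) \<Rightarrow> 'a topology \<Rightarrow> bool" where
  "p_normed smul T \<longleftrightarrow>
     (\<exists>p N. 0 < p \<and> p \<le> 1 \<and> is_p_norm smul p N \<and> p_norm_generates N T)"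

end

theory Submission
  imports Defs
begin

text \<open>The substance is that the two topological conditions produce a bounded neighbourhood \<open>V\<close> of \<open>0\<close>;
  a p-norm then comes from the Aoki-Rolewicz construction. With \<open>V\<close> balanced, its gauge \<open>q\<close> is
  homogeneous and satisfies \<open>q (x + y + z) \<le> K * max (q x) (max (q y) (q z))\<close>. Choosing \<open>p\<close> with
  \<open>K powr p = 2\<close>, the largest subadditive function below \<open>q powr p\<close> is at least half of it, hence
  is a p-norm for the same topology.\<close>

section \<open>Subadditive hulls\<close>

text \<open>\<open>z\<close> is the entry at which the partial sums first exceed \<open>t\<close>,
  or the last entry if none does.\<close>

lemma sum_list_split_at_threshold:
  fixes f :: "'a \<Rightarrow> real"
  assumes "\<And>x. f x \<ge> 0" "xs \<noteq> []" "0 \<le> t" "t \<le> sum_list (map f xs)"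
  shows "\<exists>ys z zs. xs = ys @ z # zs \<and> sum_list (map f ys) \<le> t
           \<and> sum_list (map f zs) \<le> sum_list (map f xs) - t"
  using assms(2-)
proof (induction xs arbitrary: t)
  case (Cons a as)
  show ?case
  proof (cases "f a > t \<or> as = []")
    case True
    then show ?thesis
      using Cons.prems by (intro exI[of _ "[]"] exI[of _ a] exI[of _ as]) auto
  next
    case False
    then obtain ys z zs where "as = ys @ z # zs" "sum_list (map f ys) \<le> t - f a"
        "sum_list (map f zs) \<le> sum_list (map f as) - (t - f a)"
      using Cons.IH[of "t - f a"] Cons.prems by fastforce
    then show ?thesis
      by (intro exI[of _ "a # ys"] exI[of _ z] exI[of _ zs]) auto
  qed
qed simp

text \<open>Cut the list at half of the total: the two outer parts each carry at most half of it, so by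
  induction their sums have \<open>f\<close>-value at most the total.\<close>

lemma quasi_subadditive_sum_list:
  fixes f :: "'a::comm_monoid_add \<Rightarrow> real"
  assumes nonneg: "\<And>x. f x \<ge> 0" and zero: "f 0 = 0"
    and quasi: "\<And>x y z. f (x + y + z) \<le> 2 * max (f x) (max (f y) (f z))"
  shows "f (sum_list xs) \<le> 2 * sum_list (map f xs)"
proof (induction xs rule: length_induct)
  case (1 xs)
  define S where "S = sum_list (map f xs)"
  have sum_nonneg: "0 \<le> sum_list (map f us)" for us
    by (rule sum_list_nonneg) (use nonneg in auto)
  show ?case
  proof (cases "xs = []")
    case False
    obtain ys z zs where split: "xs = ys @ z # zs" "sum_list (map f ys) \<le> S / 2"
        "sum_list (map f zs) \<le> S / 2"
    proof -
      have "S - S / 2 = S / 2" by simp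
      moreover have "\<exists>ys z zs. xs = ys @ z # zs \<and> sum_list (map f ys) \<le> S / 2
              \<and> sum_list (map f zs) \<le> S - S / 2"
        unfolding S_def using sum_nonneg[of xs] False
        by (intro sum_list_split_at_threshold nonneg) simp_all
      ultimately show thesis using that by metis
    qed
    have "f (sum_list ys) \<le> 2 * sum_list (map f ys)" "f (sum_list zs) \<le> 2 * sum_list (map f zs)"
      using 1 split(1) by auto
    \<comment> \<open>The cut entry is also at most the total, so one application of
      \<open>quasi\<close> to three blocks suffices and the constant 2 does not grow with the
      length.\<close>
    moreover have "f z \<le> S"
      using split(1) sum_nonneg[of ys] sum_nonneg[of zs] unfolding S_def by simp
    ultimately have "max (f (sum_list ys)) (max (f z) (f (sum_list zs))) \<le> S"
      using split by simp
    moreover have "sum_list xs = sum_list ys + z + sum_list zs"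
      using split(1) by (simp add: add.assoc)
    ultimately show ?thesis
      using quasi[of "sum_list ys" z "sum_list zs"] unfolding S_def by (simp del: max.bounded_iff)
  qed (simp add: zero)
qed

text \<open>Lists allow repeated summands, and concatenating them yields subadditivity. The empty
  list makes the value at 0 vanish when \<open>f\<close> is nonnegative.\<close>

definition subadditive_hull :: "('a::comm_monoid_add \<Rightarrow> real) \<Rightarrow> 'a \<Rightarrow> real" where
  "subadditive_hull f x = Inf {sum_list (map f xs) | xs. sum_list xs = x}"

context
  fixes f :: "'a::comm_monoid_add \<Rightarrow> real"
  assumes nonneg: "\<And>x. f x \<ge> 0"
begin

lemma subadditive_hull_lower: "subadditive_hull f (sum_list xs) \<le> sum_list (map f xs)"
  unfolding subadditive_hull_def
proof (rule cInf_lower)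
  have "0 \<le> sum_list (map f us)" for us
    by (rule sum_list_nonneg) (use nonneg in auto)
  then show "bdd_below {sum_list (map f ys) | ys. sum_list ys = sum_list xs}"
    by (auto intro: bdd_belowI[of _ 0])
qed auto

lemma subadditive_hull_le: "subadditive_hull f x \<le> f x"
  using subadditive_hull_lower[of "[x]"] by simp

lemma subadditive_hull_greatest:
  assumes "\<And>xs. sum_list xs = x \<Longrightarrow> b \<le> sum_list (map f xs)"
  shows "b \<le> subadditive_hull f x"
proof -
  have "sum_list [x] = x" by simp
  then have "{sum_list (map f xs) | xs. sum_list xs = x} \<noteq> {}" by blast
  then show ?thesis unfolding subadditive_hull_def by (rule cInf_greatest) (use assms in auto)
qed

text \<open>Decompositions of \<open>x\<close> and of \<open>y\<close> concatenate to one of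
  \<open>x + y\<close>; the two infima are taken one after the other.\<close>

lemma subadditive_hull_add:
  "subadditive_hull f (x + y) \<le> subadditive_hull f x + subadditive_hull f y"
proof -
  have "subadditive_hull f (x + y) - sum_list (map f xs) \<le> subadditive_hull f y"
    if "sum_list xs = x" for xs
  proof (rule subadditive_hull_greatest)
    fix ys assume "sum_list ys = y"
    then show "subadditive_hull f (x + y) - sum_list (map f xs) \<le> sum_list (map f ys)"
      using subadditive_hull_lower[of "xs @ ys"] that by simp
  qed
  then have "subadditive_hull f (x + y) - subadditive_hull f y \<le> subadditive_hull f x"
    by (intro subadditive_hull_greatest) (simp add: algebra_simps)
  then show ?thesis by simp
qed

end

section \<open>Neighbourhoods and bounded sets\<close>

text \<open>\<open>p_norm_generates\<close> only tests sets against balls; that the balls pass the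
  test themselves comes from the triangle inequality.\<close>

lemma openin_p_norm_ball:
  assumes gen: "p_norm_generates N T" and tri: "\<And>x y. N (x + y) \<le> N x + N y"
  shows "openin T {y. N (y - x) < r}"
proof -
  have "\<exists>s>0. {z. N (z - y) < s} \<subseteq> {y. N (y - x) < r}" if y: "N (y - x) < r" for y
  proof -
    have "N (z - x) < r" if "N (z - y) < r - N (y - x)" for z
      using tri[of "z - y" "y - x"] that by simp
    then show ?thesis using y by (intro exI[of _ "r - N (y - x)"]) auto
  qed
  then show ?thesis using gen unfolding p_norm_generates_def by simp
qed

text \<open>\<open>tvs\<close> is repackaged on top of \<open>vector_space\<close> to inherit its
  lemmas. The scalar field stays generic, so the real and complex cases share one proof.\<close>

locale topological_vs = vector_space smul
  for smul :: "'k::real_normed_field \<Rightarrow> 'a::ab_group_add \<Rightarrow> 'a" +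
  fixes T :: "'a topology"
  assumes topspace_UNIV [simp]: "topspace T = UNIV"
    and Hausdorff: "Hausdorff_space T"
    and add_cont: "continuous_map (prod_topology T T) T (\<lambda>(x, y). x + y)"
    and smul_cont: "continuous_map (prod_topology euclidean T) T (\<lambda>(c, x). smul c x)"

lemma tvs_iff_topological_vs: "tvs smul T \<longleftrightarrow> topological_vs smul T"
  by (simp add: tvs_def topological_vs_def topological_vs_axioms_def)

context topological_vs
begin

lemma open_translate:
  assumes "openin T U" shows "openin T {x. a + x \<in> U}"
proof -
  have "continuous_map T (prod_topology T T) (\<lambda>x. (a, x))"
    by (intro continuous_map_pairedI) auto
  from continuous_map_compose[OF this add_cont]
  have "continuous_map T T (\<lambda>x. a + x)" by (simp add: o_def)
  from openin_continuous_map_preimage[OF this assms] show ?thesis by simp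
qed

lemma open_smul:
  assumes "openin T U" shows "openin T {x. smul c x \<in> U}"
proof -
  have "continuous_map T (prod_topology euclidean T) (\<lambda>x. (c, x))"
    by (intro continuous_map_pairedI) auto
  from continuous_map_compose[OF this smul_cont]
  have "continuous_map T T (\<lambda>x. smul c x)" by (simp add: o_def)
  from openin_continuous_map_preimage[OF this assms] show ?thesis by simp
qed

lemma absorbing:
  assumes "openin T U" "0 \<in> U"
  obtains d where "d > 0" "\<And>c. norm c < d \<Longrightarrow> smul c x \<in> U"
proof -
  have "continuous_map euclidean (prod_topology euclidean T) (\<lambda>c. (c, x))"
    by (intro continuous_map_pairedI) auto
  from continuous_map_compose[OF this smul_cont]
  have "continuous_map euclidean T (\<lambda>c. smul c x)" by (simp add: o_def)
  from openin_continuous_map_preimage[OF this assms(1)]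
  have "open {c. smul c x \<in> U}" by simp
  with assms(2) obtain d where "d > 0" "ball 0 d \<subseteq> {c. smul c x \<in> U}"
    using open_contains_ball by (metis (no_types, lifting) mem_Collect_eq scale_zero_left)
  then show ?thesis by (intro that[of d]) auto
qed

lemma add_nhd:
  assumes "openin T U" "0 \<in> U"
  obtains V where "openin T V" "0 \<in> V" "\<And>x y. x \<in> V \<Longrightarrow> y \<in> V \<Longrightarrow> x + y \<in> U"
proof -
  from openin_continuous_map_preimage[OF add_cont assms(1)]
  have "openin (prod_topology T T) {z. fst z + snd z \<in> U}" by (simp add: case_prod_beta)
  moreover have "(0, 0) \<in> {z. fst z + snd z \<in> U}" using assms by simp
  ultimately obtain A B where AB: "openin T A" "openin T B" "0 \<in> A" "0 \<in> B"
      "A \<times> B \<subseteq> {z. fst z + snd z \<in> U}"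
    by (force simp only: openin_prod_topology_alt)
  show ?thesis
    by (rule that[of "A \<inter> B"]) (use AB in auto)
qed

section \<open>Balanced neighbourhoods of 0\<close>

definition balanced :: "'a set \<Rightarrow> bool" where
  "balanced V \<longleftrightarrow> (\<forall>c x. norm c \<le> 1 \<longrightarrow> x \<in> V \<longrightarrow> smul c x \<in> V)"

lemma balancedD: "balanced V \<Longrightarrow> norm c \<le> 1 \<Longrightarrow> x \<in> V \<Longrightarrow> smul c x \<in> V"
  by (simp add: balanced_def)

text \<open>Continuity of scalar multiplication at \<open>(0, 0)\<close> gives \<open>d\<close> and
  \<open>B\<close> such that the multiple of \<open>B\<close> by \<open>c\<close> lies in
  \<open>U\<close> whenever \<open>norm c < d\<close>; the union of these multiples over nonzero
  \<open>c\<close> is the required set.\<close>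

lemma balanced_nhd:
  assumes "openin T U" "0 \<in> U"
  obtains V where "openin T V" "0 \<in> V" "V \<subseteq> U" "balanced V"
proof -
  from openin_continuous_map_preimage[OF smul_cont assms(1)]
  have "openin (prod_topology euclidean T) {z. smul (fst z) (snd z) \<in> U}"
    by (simp add: case_prod_beta)
  moreover have "(0, 0) \<in> {z. smul (fst z) (snd z) \<in> U}" using assms by simp
  ultimately obtain A B where AB: "open A" "openin T B" "0 \<in> A" "0 \<in> B"
      "A \<times> B \<subseteq> {z. smul (fst z) (snd z) \<in> U}"
    by (force simp only: openin_prod_topology_alt open_openin)
  then obtain d where d: "d > 0" "ball 0 d \<subseteq> A"
    by (meson open_contains_ball)
  \<comment> \<open>Each multiple of \<open>B\<close> is written as a preimage under scaling by
    \<open>inverse c\<close>, so that \<open>open_smul\<close> applies; hence \<open>c = 0\<close>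
    is left out.\<close>
  define V where "V = (\<Union>c\<in>{c. norm c < d \<and> c \<noteq> 0}. {x. smul (inverse c) x \<in> B})"
  have mem: "x \<in> V \<longleftrightarrow> (\<exists>c. norm c < d \<and> c \<noteq> 0 \<and> smul (inverse c) x \<in> B)" for x
    by (auto simp: V_def)
  show ?thesis
  proof (rule that[of V])
    show "openin T V" unfolding V_def using AB open_smul by blast
    have "norm (of_real (d/2) :: 'k) < d" "(of_real (d/2) :: 'k) \<noteq> 0"
      using d by (simp_all del: of_real_divide)
    then show 0: "0 \<in> V" unfolding mem using AB(4) by (metis scale_zero_right)
    show "V \<subseteq> U"
    proof
      fix x assume "x \<in> V"
      then obtain c where c: "norm c < d" "c \<noteq> 0" "smul (inverse c) x \<in> B"
        unfolding mem by blast
      then have "(c, smul (inverse c) x) \<in> A \<times> B" using d by auto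
      then have "smul c (smul (inverse c) x) \<in> U" using AB(5) by fastforce
      then show "x \<in> U" using c by simp
    qed
    show "balanced V" unfolding balanced_def
    proof (intro allI impI)
      fix a :: 'k and x assume a: "norm a \<le> 1" and "x \<in> V"
      then obtain c where c: "norm c < d" "c \<noteq> 0" "smul (inverse c) x \<in> B"
        unfolding mem by blast
      show "smul a x \<in> V"
      proof (cases "a = 0")
        case False
        have "norm (a * c) \<le> norm c" using a by (simp add: norm_mult mult_left_le_one_le)
        then show ?thesis unfolding mem
          using False c by (intro exI[of _ "a * c"]) (auto simp: field_simps)
      qed (simp add: 0)
    qed
  qed
qed

lemma add_balanced_nhd:
  assumes "openin T U" "0 \<in> U"
  obtains V where "openin T V" "0 \<in> V" "balanced V" "\<And>x y. x \<in> V \<Longrightarrow> y \<in> V \<Longrightarrow> x + y \<in> U"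
proof -
  obtain V where V: "openin T V" "0 \<in> V" "\<And>x y. x \<in> V \<Longrightarrow> y \<in> V \<Longrightarrow> x + y \<in> U"
    using add_nhd[OF assms] by blast
  obtain W where "openin T W" "0 \<in> W" "W \<subseteq> V" "balanced W"
    using balanced_nhd[OF V(1,2)] by blast
  then show ?thesis using V(3) that by (meson subsetD)
qed

section \<open>Bounded sets\<close>

lemma mem_smul_image: "t \<noteq> 0 \<Longrightarrow> x \<in> smul t ` U \<longleftrightarrow> smul (inverse t) x \<in> U"
  by (metis (no_types, lifting) imageE imageI left_inverse right_inverse scale_one scale_scale)

text \<open>Since \<open>norm t > s > 0\<close> makes \<open>t\<close> invertible, the dilated
  neighbourhood can be replaced by a pointwise condition on \<open>inverse t\<close>.\<close>

lemma bounded_iff: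
  "tvs_bounded smul T B \<longleftrightarrow>
     (\<forall>U. openin T U \<and> 0 \<in> U \<longrightarrow> (\<exists>s>0. \<forall>t. norm t > s \<longrightarrow> (\<forall>x\<in>B. smul (inverse t) x \<in> U)))"
proof -
  have eq: "B \<subseteq> smul t ` U \<longleftrightarrow> (\<forall>x\<in>B. smul (inverse t) x \<in> U)" if "norm t > s" "s > 0" for s t U
  proof -
    have "t \<noteq> 0" using that by auto
    then show ?thesis by (auto simp: subset_iff mem_smul_image)
  qed
  show ?thesis unfolding tvs_bounded_def by (simp add: eq cong: conj_cong)
qed

lemma boundedE:
  assumes "tvs_bounded smul T B" "openin T U" "0 \<in> U"
  obtains s where "s > 0" "\<And>t x. norm t > s \<Longrightarrow> x \<in> B \<Longrightarrow> smul (inverse t) x \<in> U"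
  using assms(1)[unfolded bounded_iff, rule_format, OF conjI, OF assms(2,3)] that by blast

lemma bounded_subset: "tvs_bounded smul T B \<Longrightarrow> A \<subseteq> B \<Longrightarrow> tvs_bounded smul T A"
  unfolding tvs_bounded_def by (meson order_trans)

lemma bounded_empty: "tvs_bounded smul T {}"
  by (auto simp: bounded_iff intro: exI[of _ 1])

lemma bounded_Un:
  assumes "tvs_bounded smul T A" "tvs_bounded smul T B"
  shows "tvs_bounded smul T (A \<union> B)"
  unfolding bounded_iff
proof (intro allI impI)
  fix U assume U: "openin T U \<and> 0 \<in> U"
  obtain s where s: "s > 0" "\<And>t x. norm t > s \<Longrightarrow> x \<in> A \<Longrightarrow> smul (inverse t) x \<in> U"
    using boundedE[OF assms(1)] U by blast
  obtain r where r: "r > 0" "\<And>t x. norm t > r \<Longrightarrow> x \<in> B \<Longrightarrow> smul (inverse t) x \<in> U"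
    using boundedE[OF assms(2)] U by blast
  show "\<exists>s>0. \<forall>t. norm t > s \<longrightarrow> (\<forall>x\<in>A \<union> B. smul (inverse t) x \<in> U)"
    by (rule exI[of _ "max s r"]) (use s r in auto)
qed

lemma bounded_finite_UN:
  "finite I \<Longrightarrow> (\<And>i. i \<in> I \<Longrightarrow> tvs_bounded smul T (B i)) \<Longrightarrow> tvs_bounded smul T (\<Union>i\<in>I. B i)"
  by (induction I rule: finite_induct) (auto intro: bounded_empty bounded_Un)

lemma bounded_singleton: "tvs_bounded smul T {x}"
  unfolding bounded_iff
proof (intro allI impI)
  fix U assume U: "openin T U \<and> 0 \<in> U"
  obtain d where d: "d > 0" "\<And>c. norm c < d \<Longrightarrow> smul c x \<in> U" using absorbing U by blast
  have "norm (inverse t) < d" if "norm t > inverse d" for t :: 'k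
    using d(1) that less_imp_inverse_less[OF that] by (simp add: norm_inverse)
  then show "\<exists>s>0. \<forall>t. norm t > s \<longrightarrow> (\<forall>y\<in>{x}. smul (inverse t) y \<in> U)"
    using d by (intro exI[of _ "inverse d"]) auto
qed

text \<open>A tail of the sequence lies in a balanced neighbourhood, which scalars of norm at most 1
  preserve; the remaining terms are finitely many.\<close>

lemma bounded_range_null_sequence:
  assumes "limitin T w 0 sequentially"
  shows "tvs_bounded smul T (range w)"
  unfolding bounded_iff
proof (intro allI impI)
  fix U assume U: "openin T U \<and> 0 \<in> U"
  obtain V where V: "openin T V" "0 \<in> V" "V \<subseteq> U" "balanced V" using balanced_nhd U by blast
  then obtain M where M: "\<And>i. i \<ge> M \<Longrightarrow> w i \<in> V"
    using assms unfolding limitin_sequentially by blast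
  have "tvs_bounded smul T (\<Union>i\<in>{..<M}. {w i})"
    by (intro bounded_finite_UN bounded_singleton) auto
  then obtain s where s: "s > 0" "\<And>t x. norm t > s \<Longrightarrow> x \<in> (\<Union>i\<in>{..<M}. {w i}) \<Longrightarrow> smul (inverse t) x \<in> U"
    using boundedE U by blast
  show "\<exists>s>0. \<forall>t. norm t > s \<longrightarrow> (\<forall>x\<in>range w. smul (inverse t) x \<in> U)"
  \<comment> \<open>\<open>s\<close> handles the first \<open>M\<close> terms; the 1 ensures
    \<open>norm (inverse t) \<le> 1\<close> for the tail.\<close>
  proof (intro exI[of _ "max s 1"] conjI allI impI ballI)
    show "max s 1 > 0" by simp
    fix t :: 'k and x assume t: "norm t > max s 1" and "x \<in> range w"
    then obtain i where x: "x = w i" by blast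
    show "smul (inverse t) x \<in> U"
    proof (cases "i < M")
      case True then show ?thesis using s(2)[of t x] t x by auto
    next
      case False
      have "norm (inverse t) \<le> 1" using t by (simp add: norm_inverse inverse_le_1_iff)
      then show ?thesis using balancedD[OF V(4) _ M[of i]] False V(3) x by auto
    qed
  qed
qed

section \<open>Frechet-Urysohn spaces\<close>

text \<open>One application of the Frechet-Urysohn property suffices. If no \<open>C n\<close> were a neighbourhood
  of \<open>0\<close>, then \<open>0\<close> would be an accumulation point of the union of the sets \<open>y n + (UNIV - C n)\<close>, each
  cut down to a neighbourhood of \<open>y n \<noteq> 0\<close> that stays away from \<open>0\<close>, where \<open>y n\<close> tends to \<open>0\<close>. The
  cut forces a sequence of this union tending to \<open>0\<close> to use indices \<open>n\<close> tending to infinity, so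
  subtracting the \<open>y n\<close> yields a bounded sequence that is contained in no \<open>C n\<close>.\<close>

lemma bounded_nhd_if_frechet_urysohn:
  assumes FU: "frechet_urysohn T" and fund: "has_fundamental_bounded_seq smul T"
  obtains U where "openin T U" "0 \<in> U" "tvs_bounded smul T U"
proof (rule ccontr)
  assume "\<not> thesis"
  with that have no_nhd: "\<not> tvs_bounded smul T U" if "openin T U" "0 \<in> U" for U
    using that by blast
  obtain B where B: "\<And>n::nat. tvs_bounded smul T (B n)"
      "\<And>S. tvs_bounded smul T S \<Longrightarrow> \<exists>n. S \<subseteq> B n"
    using fund unfolding has_fundamental_bounded_seq_def by blast
  \<comment> \<open>Passing to increasing unions lets containment in one set persist for all larger
    indices.\<close>
  define C where "C n = (\<Union>i\<in>{..n}. B i)" for n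
  have C_bdd: "tvs_bounded smul T (C n)" for n
    unfolding C_def by (intro bounded_finite_UN B) auto
  have C_mono: "C m \<subseteq> C n" if "m \<le> n" for m n
    using that unfolding C_def by (intro UN_mono) auto
  \<comment> \<open>In the zero space the whole space would be a bounded neighbourhood of 0.\<close>
  have "\<exists>y::'a. y \<noteq> 0"
  proof (rule ccontr)
    assume "\<nexists>y::'a. y \<noteq> 0"
    then have "(UNIV::'a set) = {0}" by auto
    then show False
      using no_nhd[of UNIV] bounded_singleton[of 0] openin_topspace[of T] by simp
  qed
  then obtain y0 :: 'a where "y0 \<noteq> 0" by blast
  define y where "y n = smul (inverse (of_nat (Suc n))) y0" for n
  have y_ne: "y n \<noteq> 0" for n
    using \<open>y0 \<noteq> 0\<close> unfolding y_def by (simp del: of_nat_Suc)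
  have y_lim: "\<exists>M. \<forall>n\<ge>M. y n \<in> O'" if O': "openin T O'" "0 \<in> O'" for O'
  proof -
    obtain d where d: "d > 0" "\<And>c. norm c < d \<Longrightarrow> smul c y0 \<in> O'" using absorbing O' by blast
    obtain M where M: "inverse (real (Suc M)) < d" using reals_Archimedean d by blast
    have "norm (inverse (of_nat (Suc n)) :: 'k) < d" if "n \<ge> M" for n
    proof -
      have "norm (inverse (of_nat (Suc n)) :: 'k) = inverse (real (Suc n))"
        by (simp add: norm_inverse del: of_nat_Suc)
      also have "\<dots> \<le> inverse (real (Suc M))" using that by (simp add: le_imp_inverse_le)
      finally show ?thesis using M by simp
    qed
    then show ?thesis using d(2) unfolding y_def by blast
  qed
  have "\<exists>U V. openin T U \<and> openin T V \<and> 0 \<in> U \<and> y n \<in> V \<and> disjnt U V" for n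
    using Hausdorff y_ne[of n] unfolding Hausdorff_space_def by (metis UNIV_I topspace_UNIV)
  then obtain U V where UV: "\<And>n. openin T (U n)" "\<And>n. openin T (V n)" "\<And>n. 0 \<in> U n"
      "\<And>n. y n \<in> V n" "\<And>n. disjnt (U n) (V n)" by metis
  define A where "A = {z. \<exists>n. z \<in> V n \<and> z - y n \<notin> C n}"
  have "0 \<in> T closure_of A"
    unfolding in_closure_of
  proof (intro conjI allI impI)
    fix O' assume O': "0 \<in> O' \<and> openin T O'"
    then obtain n where n: "y n \<in> O'" using y_lim by blast
    \<comment> \<open>Translated back by \<open>y n\<close>, this is a neighbourhood of 0, which
      cannot fit into the bounded set \<open>C n\<close>.\<close>
    have "openin T {w. y n + w \<in> O' \<inter> V n}" using O' UV(2) by (intro open_translate) auto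
    moreover have "0 \<in> {w. y n + w \<in> O' \<inter> V n}" using n UV(4) by simp
    ultimately have "\<not> {w. y n + w \<in> O' \<inter> V n} \<subseteq> C n"
      using no_nhd bounded_subset[OF C_bdd] by blast
    then obtain w where w: "y n + w \<in> O'" "y n + w \<in> V n" "w \<notin> C n" by blast
    then have "y n + w \<in> A" unfolding A_def by (auto intro!: exI[of _ n])
    then show "\<exists>z. z \<in> A \<and> z \<in> O'" using w by blast
  qed simp
  then obtain s :: "nat \<Rightarrow> 'a" where s: "\<And>i. s i \<in> A" "limitin T s 0 sequentially"
    using FU unfolding frechet_urysohn_def by blast
  then have "\<forall>i. \<exists>n. s i \<in> V n \<and> s i - y n \<notin> C n" unfolding A_def by blast
  then obtain \<nu> where \<nu>: "\<And>i. s i \<in> V (\<nu> i)" "\<And>i. s i - y (\<nu> i) \<notin> C (\<nu> i)" by metis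
  have s_ev: "\<forall>\<^sub>F i in sequentially. s i \<in> O'" if "openin T O'" "0 \<in> O'" for O'
    using s(2) that unfolding limitin_def by blast
  have \<nu>_lim: "\<forall>\<^sub>F i in sequentially. \<nu> i \<ge> M" for M
  proof -
    \<comment> \<open>\<open>U n\<close> is disjoint from \<open>V n\<close>, so a point lying in
      \<open>U n\<close> for every \<open>n < M\<close> can only lie in a \<open>V n\<close> with
      \<open>n \<ge> M\<close>.\<close>
    have "\<forall>\<^sub>F i in sequentially. \<forall>n\<in>{..<M}. s i \<in> U n"
      by (rule eventually_ball_finite) (use UV s_ev in auto)
    then show ?thesis
    proof eventually_elim
      case (elim i)
      then show ?case using \<nu>(1)[of i] UV(5)[of "\<nu> i"] unfolding disjnt_def
        by (meson disjoint_iff lessThan_iff not_le)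
    qed
  qed
  define w where "w i = s i - y (\<nu> i)" for i
  have "limitin T w 0 sequentially"
    unfolding limitin_def
  proof (intro conjI allI impI)
    fix O' assume O': "openin T O' \<and> 0 \<in> O'"
    then obtain W where W: "openin T W" "0 \<in> W" "balanced W"
        "\<And>x y. x \<in> W \<Longrightarrow> y \<in> W \<Longrightarrow> x + y \<in> O'"
      using add_balanced_nhd by blast
    obtain M where M: "\<And>n. n \<ge> M \<Longrightarrow> y n \<in> W" using y_lim W by blast
    from s_ev[OF W(1,2)] \<nu>_lim[of M] show "\<forall>\<^sub>F i in sequentially. w i \<in> O'"
    proof eventually_elim
      case (elim i)
      have "smul (-1) (y (\<nu> i)) \<in> W" by (rule balancedD[OF W(3)]) (use M elim in auto)
      from W(4)[OF elim(1) this] show ?case unfolding w_def by simp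
    qed
  qed simp
  then obtain m where "range w \<subseteq> B m" using bounded_range_null_sequence B(2) by blast
  then have m: "range w \<subseteq> C m" unfolding C_def by blast
  \<comment> \<open>For such \<open>i\<close>, \<open>w i\<close> lies in \<open>C m\<close> and
    hence in \<open>C (\<nu> i)\<close>, against the choice of \<open>\<nu> i\<close>.\<close>
  obtain i where "\<nu> i \<ge> m" using \<nu>_lim[of m] unfolding eventually_sequentially by blast
  then show False using m C_mono \<nu>(2)[of i] unfolding w_def by blast
qed

section \<open>The Aoki-Rolewicz construction\<close>

text \<open>The Minkowski functional of \<open>V\<close>; real factors are embedded by
  \<open>of_real\<close> because the scalar field is generic.\<close>

definition gauge_of :: "'a set \<Rightarrow> 'a \<Rightarrow> real" where
  "gauge_of V x = Inf {l. l > 0 \<and> smul (of_real (inverse l)) x \<in> V}"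

lemma gauge_of_le:
  assumes "l > 0" "smul (of_real (inverse l)) x \<in> V"
  shows "gauge_of V x \<le> l"
  unfolding gauge_of_def
  by (rule cInf_lower) (use assms in \<open>auto intro: bdd_belowI[of _ 0]\<close>)

context
  fixes V :: "'a set"
  assumes V_open: "openin T V" and V_0: "0 \<in> V" and V_bal: "balanced V"
begin

lemma gauge_of_set_nonempty: "{l. l > 0 \<and> smul (of_real (inverse l)) x \<in> V} \<noteq> {}"
proof -
  obtain d where d: "d > 0" "\<And>c. norm c < d \<Longrightarrow> smul c x \<in> V"
    using absorbing[OF V_open V_0] by blast
  have "norm (of_real (inverse (2 / d)) :: 'k) < d"
    unfolding norm_of_real using d(1) by simp
  then have "2 / d \<in> {l. l > 0 \<and> smul (of_real (inverse l)) x \<in> V}"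
    using d(1) d(2)[of "of_real (inverse (2 / d))"] by simp
  then show ?thesis by blast
qed

lemma gauge_of_nonneg: "gauge_of V x \<ge> 0"
  unfolding gauge_of_def by (rule cInf_greatest[OF gauge_of_set_nonempty]) auto

text \<open>Some \<open>m < l\<close> already brings \<open>x\<close> into \<open>V\<close>, and
  \<open>m / l\<close> has norm at most 1, so balancedness passes from \<open>m\<close> to
  \<open>l\<close>.\<close>

lemma mem_if_gauge_of_less:
  assumes "gauge_of V x < l"
  shows "smul (of_real (inverse l)) x \<in> V"
proof -
  obtain m where m: "m > 0" "smul (of_real (inverse m)) x \<in> V" "m < l"
    using cInf_lessD[OF gauge_of_set_nonempty assms[unfolded gauge_of_def]] by blast
  have "norm (of_real (m / l) :: 'k) \<le> 1" unfolding norm_of_real using m by simp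
  from balancedD[OF V_bal this m(2)]
  have "smul (of_real (m / l * inverse m)) x \<in> V" by (simp only: scale_scale of_real_mult)
  moreover have "m / l * inverse m = inverse l" using m by (simp add: field_simps)
  ultimately show ?thesis by (simp only:)
qed

text \<open>\<open>c / of_real (norm c)\<close> has norm 1 and so preserves \<open>V\<close>. The
  infimum need not be attained, hence the argument runs over all \<open>l\<close> above it.\<close>

lemma gauge_of_smul_le:
  assumes "c \<noteq> 0"
  shows "gauge_of V (smul c x) \<le> norm c * gauge_of V x"
proof -
  have "gauge_of V (smul c x) / norm c \<le> l" if "gauge_of V x < l" for l
  proof -
    have l: "l > 0" using that gauge_of_nonneg[of x] by linarith
    have "norm (c / of_real (norm c)) \<le> 1" using assms by (simp add: norm_divide)
    from balancedD[OF V_bal this mem_if_gauge_of_less[OF that]]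
    have "smul (of_real (inverse (norm c * l))) (smul c x) \<in> V"
      using assms l by (simp add: field_simps)
    then have "gauge_of V (smul c x) \<le> norm c * l"
      using assms l by (intro gauge_of_le) auto
    then show ?thesis using assms by (simp add: field_simps)
  qed
  then have "gauge_of V (smul c x) / norm c \<le> gauge_of V x" by (rule dense_ge)
  then show ?thesis using assms by (simp add: field_simps)
qed

lemma gauge_of_zero: "gauge_of V 0 = 0"
proof -
  have "gauge_of V 0 \<le> 0" by (rule dense_ge) (use V_0 in \<open>auto intro: gauge_of_le\<close>)
  then show ?thesis using gauge_of_nonneg[of 0] by simp
qed

lemma gauge_of_smul: "gauge_of V (smul c x) = norm c * gauge_of V x"
proof (cases "c = 0")
  case False
  have "gauge_of V x \<le> norm (inverse c) * gauge_of V (smul c x)"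
    using gauge_of_smul_le[of "inverse c" "smul c x"] False by simp
  then have "norm c * gauge_of V x \<le> gauge_of V (smul c x)"
    using False by (simp add: norm_divide field_simps)
  then show ?thesis using gauge_of_smul_le[OF False, of x] by simp
qed (simp add: gauge_of_zero)

text \<open>Boundedness lets a small multiple of \<open>V\<close> fit into \<open>U\<close>, so the
  gauge balls are at least as fine as \<open>T\<close>.\<close>

lemma mem_nhd_if_gauge_of_less:
  assumes "tvs_bounded smul T V" "openin T U" "0 \<in> U"
  obtains r where "r > 0" "\<And>x. gauge_of V x < r \<Longrightarrow> x \<in> U"
proof -
  obtain s where s: "s > 0" "\<And>t x. norm t > s \<Longrightarrow> x \<in> V \<Longrightarrow> smul (inverse t) x \<in> U"
    using boundedE[OF assms] by blast
  define r where "r = inverse (s + 1)"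
  have r: "r > 0" using s unfolding r_def by simp
  have "x \<in> U" if "gauge_of V x < r" for x
  proof -
    have "norm (of_real (inverse r) :: 'k) > s" unfolding norm_of_real r_def using s(1) by simp
    from s(2)[OF this mem_if_gauge_of_less[OF that]] show ?thesis using r by simp
  qed
  then show ?thesis using that r by blast
qed

text \<open>By the Hausdorff property a nonzero \<open>x\<close> misses some neighbourhood of 0,
  which a point of gauge 0 cannot do.\<close>

lemma gauge_of_eq_0_iff:
  assumes "tvs_bounded smul T V"
  shows "gauge_of V x = 0 \<longleftrightarrow> x = 0"
proof
  assume x: "gauge_of V x = 0"
  show "x = 0"
  proof (rule ccontr)
    assume "x \<noteq> 0"
    then obtain U W where "openin T U" "openin T W" "0 \<in> U" "x \<in> W" "disjnt U W"
      using Hausdorff unfolding Hausdorff_space_def by (metis UNIV_I topspace_UNIV)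
    then have U: "openin T U" "0 \<in> U" "x \<notin> U" by (auto simp: disjnt_iff)
    then show False using mem_nhd_if_gauge_of_less[OF assms U(1,2)] x by metis
  qed
qed (simp add: gauge_of_zero)

text \<open>Continuity of addition gives \<open>W\<close> with \<open>W + W + W\<close> inside
  \<open>V\<close>, and boundedness puts \<open>V\<close> inside \<open>K\<close> times
  \<open>W\<close>.\<close>

lemma gauge_of_quasi_subadditive:
  assumes "tvs_bounded smul T V"
  obtains K where "K \<ge> 2"
    "\<And>x y z. gauge_of V (x + y + z) \<le> K * max (gauge_of V x) (max (gauge_of V y) (gauge_of V z))"
proof -
  obtain W' where W': "openin T W'" "0 \<in> W'" "\<And>x y. x \<in> W' \<Longrightarrow> y \<in> W' \<Longrightarrow> x + y \<in> V"
    using add_nhd[OF V_open V_0] by blast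
  obtain W where W: "openin T W" "0 \<in> W" "\<And>x y. x \<in> W \<Longrightarrow> y \<in> W \<Longrightarrow> x + y \<in> W'"
    using add_nhd[OF W'(1,2)] by blast
  \<comment> \<open>Two applications of \<open>add_nhd\<close> handle four summands; the fourth is
    0.\<close>
  have W3: "x + y + z \<in> V" if "x \<in> W" "y \<in> W" "z \<in> W" for x y z
    using W'(3)[OF W(3)[OF that(1,2)] W(3)[OF that(3) W(2)]] by simp
  obtain s where s: "s > 0" "\<And>t x. norm t > s \<Longrightarrow> x \<in> V \<Longrightarrow> smul (inverse t) x \<in> W"
    using boundedE[OF assms W(1,2)] by blast
  \<comment> \<open>Beyond \<open>s\<close> for the absorption, and at least 2 so that the exponent
    chosen later is at most 1.\<close>
  define K where "K = s + 2"
  have K: "K \<ge> 2" "norm (of_real K :: 'k) > s" using s(1) unfolding K_def norm_of_real by auto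
  have "gauge_of V (x + y + z) \<le> K * max (gauge_of V x) (max (gauge_of V y) (gauge_of V z))"
    for x y z
  proof -
    have "gauge_of V (x + y + z) / K \<le> l"
      if l: "max (gauge_of V x) (max (gauge_of V y) (gauge_of V z)) < l" for l
    proof -
      have l0: "l > 0" using l gauge_of_nonneg[of x] by linarith
      have "smul (inverse (of_real K)) (smul (of_real (inverse l)) v) \<in> W" if "gauge_of V v < l" for v
        using s(2)[OF K(2)] mem_if_gauge_of_less[OF that] by blast
      then have mem: "smul (of_real (inverse (K * l))) v \<in> W" if "gauge_of V v < l" for v
        using that by simp
      have "smul (of_real (inverse (K * l))) (x + y + z) \<in> V"
        unfolding scale_right_distrib using l by (intro W3 mem) auto
      then have "gauge_of V (x + y + z) \<le> K * l"
        using K(1) l0 by (intro gauge_of_le) auto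
      then show ?thesis using K(1) by (simp add: field_simps)
    qed
    then have "gauge_of V (x + y + z) / K \<le> max (gauge_of V x) (max (gauge_of V y) (gauge_of V z))"
      by (rule dense_ge)
    then show ?thesis using K(1) by (simp add: field_simps)
  qed
  then show ?thesis using that K(1) by blast
qed

end

text \<open>Scaling by a nonzero \<open>c\<close> turns decompositions of \<open>x\<close> into
  decompositions of \<open>smul c x\<close>; the inequality for \<open>c\<close> and for
  \<open>inverse c\<close> gives equality.\<close>

lemma subadditive_hull_smul:
  fixes f :: "'a \<Rightarrow> real"
  assumes nonneg: "\<And>x. f x \<ge> 0" and "p > 0"
    and f_smul: "\<And>c x. f (smul c x) = norm c powr p * f x"
  shows "subadditive_hull f (smul c x) = norm c powr p * subadditive_hull f x"
proof -
  have map_smul: "sum_list (map f (map (smul c) xs)) = norm c powr p * sum_list (map f xs)" for c xs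
    by (simp add: f_smul sum_list_const_mult o_def)
  have sum_smul: "sum_list (map (smul c) xs) = smul c (sum_list xs)" for c xs
    by (induction xs) (simp_all add: scale_right_distrib)
  have le: "subadditive_hull f (smul c x) \<le> norm c powr p * subadditive_hull f x" if "c \<noteq> 0" for c x
  proof -
    have "subadditive_hull f (smul c x) / norm c powr p \<le> sum_list (map f xs)" if "sum_list xs = x" for xs
      using subadditive_hull_lower[of f "map (smul c) xs", OF nonneg] \<open>c \<noteq> 0\<close> that
      unfolding map_smul sum_smul by (simp add: field_simps)
    then have "subadditive_hull f (smul c x) / norm c powr p \<le> subadditive_hull f x"
      by (intro subadditive_hull_greatest[OF nonneg])
    then show ?thesis using that by (simp add: field_simps)
  qed
  show ?thesis
  proof (cases "c = 0")
    case True
    have "f 0 = 0" using f_smul[of 0 0] \<open>p > 0\<close> by simp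
    then have "subadditive_hull f 0 \<le> 0" using subadditive_hull_le[of f 0, OF nonneg] by simp
    moreover have "0 \<le> subadditive_hull f 0"
      by (intro subadditive_hull_greatest[OF nonneg] sum_list_nonneg) (use nonneg in auto)
    ultimately show ?thesis using True \<open>p > 0\<close> by simp
  next
    case False
    have "subadditive_hull f x \<le> norm (inverse c) powr p * subadditive_hull f (smul c x)"
      using le[of "inverse c" "smul c x"] False by simp
    then have "norm c powr p * subadditive_hull f x \<le> subadditive_hull f (smul c x)"
      using False by (simp add: norm_divide powr_divide field_simps)
    then show ?thesis using le[OF False, of x] by simp
  qed
qed

lemma p_normed_if_bounded_nhd:
  assumes "openin T U" "0 \<in> U" "tvs_bounded smul T U"
  shows "p_normed smul T"
proof -
  obtain V where V: "openin T V" "0 \<in> V" "V \<subseteq> U" "balanced V"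
    using balanced_nhd[OF assms(1,2)] by blast
  have bdd: "tvs_bounded smul T V" using bounded_subset assms(3) V(3) by blast
  note V' = V(1,2,4)
  obtain K where K: "K \<ge> 2"
    "\<And>x y z. gauge_of V (x + y + z) \<le> K * max (gauge_of V x) (max (gauge_of V y) (gauge_of V z))"
    using gauge_of_quasi_subadditive[OF V' bdd] by blast
  \<comment> \<open>This \<open>p\<close> gives \<open>K powr p = 2\<close>, the constant in
    \<open>quasi_subadditive_sum_list\<close>, and \<open>K \<ge> 2\<close> gives
    \<open>p \<le> 1\<close>.\<close>
  define p where "p = 1 / log 2 K"
  have "log 2 K \<ge> 1" using K(1) by simp
  then have p: "0 < p" "p \<le> 1" unfolding p_def by auto
  have "K = 2 powr (log 2 K)" using K(1) by simp
  then have "K powr p = 2 powr (log 2 K * p)" by (metis powr_powr)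
  also have "\<dots> = 2" using \<open>log 2 K \<ge> 1\<close> unfolding p_def by simp
  finally have Kp: "K powr p = 2" .
  define f where "f x = gauge_of V x powr p" for x
  note g_nonneg = gauge_of_nonneg[OF V']
  have f_nonneg: "f x \<ge> 0" for x unfolding f_def by simp
  have f_eq_0: "f x = 0 \<longleftrightarrow> x = 0" for x
    unfolding f_def using gauge_of_eq_0_iff[OF V' bdd] by simp
  have f_smul: "f (smul c x) = norm c powr p * f x" for c x
    unfolding f_def gauge_of_smul[OF V'] by (simp add: powr_mult g_nonneg)
  have max_powr: "max a b powr p = max (a powr p) (b powr p)" if "a \<ge> 0" "b \<ge> 0" for a b
    using that p(1) powr_mono2[of p a b] powr_mono2[of p b a] by (auto simp: max_def)
  have f_quasi: "f (x + y + z) \<le> 2 * max (f x) (max (f y) (f z))" for x y z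
  proof -
    have "f (x + y + z) \<le> (K * max (gauge_of V x) (max (gauge_of V y) (gauge_of V z))) powr p"
      unfolding f_def using K(2) g_nonneg p by (intro powr_mono2) auto
    also have "\<dots> = 2 * max (f x) (max (f y) (f z))"
      unfolding f_def using K(1) g_nonneg
      by (subst powr_mult) (auto simp: Kp max_powr le_max_iff_disj)
    finally show ?thesis .
  qed
  define N where "N = subadditive_hull f"
  have N_le: "N x \<le> f x" for x
    unfolding N_def by (rule subadditive_hull_le[OF f_nonneg])
  \<comment> \<open>Every decomposition costs at least half of \<open>f x\<close>; together with
    \<open>N_le\<close> this lets \<open>N\<close> inherit the topology of the gauge.\<close>
  have N_ge: "f x / 2 \<le> N x" for x
    unfolding N_def
  proof (rule subadditive_hull_greatest[OF f_nonneg])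
    fix xs assume "sum_list xs = x"
    then show "f x / 2 \<le> sum_list (map f xs)"
      using quasi_subadditive_sum_list[of f xs] f_nonneg f_eq_0 f_quasi by auto
  qed
  have N_nonneg: "N x \<ge> 0" for x using N_ge[of x] f_nonneg[of x] by linarith
  have "is_p_norm smul p N"
    unfolding is_p_norm_def
  proof (intro conjI allI)
    show "N x = 0 \<longleftrightarrow> x = 0" for x
      using N_le[of x] N_ge[of x] f_nonneg[of x] N_nonneg[of x] f_eq_0[of x] by auto
    show "N (smul c x) = norm c powr p * N x" for c x
      unfolding N_def using f_nonneg p(1) f_smul by (rule subadditive_hull_smul)
    show "N (x + y) \<le> N x + N y" for x y
      unfolding N_def using f_nonneg by (rule subadditive_hull_add)
  qed (rule N_nonneg)
  moreover have "p_norm_generates N T"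
    unfolding p_norm_generates_def
  proof (intro allI iffI ballI)
    fix O' x assume O': "openin T O'" "x \<in> O'"
    then have "openin T {v. x + v \<in> O'}" "0 \<in> {v. x + v \<in> O'}" by (auto intro: open_translate)
    then obtain r where r: "r > 0" "\<And>v. gauge_of V v < r \<Longrightarrow> v \<in> {v. x + v \<in> O'}"
      using mem_nhd_if_gauge_of_less[OF V' bdd] by metis
    \<comment> \<open>The factor 1/2 compensates for the loss in \<open>N_ge\<close>.\<close>
    have "y \<in> O'" if "N (y - x) < r powr p / 2" for y
    proof -
      have "gauge_of V (y - x) powr p < r powr p"
        using that N_ge[of "y - x"] unfolding f_def by simp
      then have "gauge_of V (y - x) < r"
        using r(1) p(1) powr_mono2[of p r "gauge_of V (y - x)"] by linarith
      then show ?thesis using r(2)[of "y - x"] by simp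
    qed
    then show "\<exists>r>0. {y. N (y - x) < r} \<subseteq> O'"
      using r(1) by (intro exI[of _ "r powr p / 2"]) auto
  next
    fix O' assume O': "\<forall>x\<in>O'. \<exists>r>0. {y. N (y - x) < r} \<subseteq> O'"
    show "openin T O'"
    proof (subst openin_subopen, intro ballI)
      fix x assume "x \<in> O'"
      then obtain r where r: "r > 0" "{y. N (y - x) < r} \<subseteq> O'" using O' by blast
      \<comment> \<open>Solves \<open>l powr p = r / 2\<close>; the half turns the non-strict bound
        from \<open>gauge_of_le\<close> into \<open>N (y - x) < r\<close>.\<close>
      define l where "l = (r / 2) powr (1 / p)"
      have l: "l > 0" "l powr p = r / 2" unfolding l_def using r(1) p(1) by (auto simp: powr_powr)
      define W where "W = {y. - x + y \<in> {v. smul (of_real (inverse l)) v \<in> V}}"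
      have "openin T W" unfolding W_def by (intro open_translate open_smul V(1))
      moreover have "x \<in> W" unfolding W_def using V(2) by simp
      moreover have "W \<subseteq> O'"
      proof
        fix y assume "y \<in> W"
        then have "gauge_of V (y - x) \<le> l"
          using l(1) unfolding W_def by (intro gauge_of_le) auto
        then have "f (y - x) \<le> r / 2"
          unfolding f_def using g_nonneg p(1) l(2) powr_mono2 by (metis less_eq_real_def)
        then have "N (y - x) < r" using N_le[of "y - x"] r(1) by simp
        then show "y \<in> O'" using r(2) by blast
      qed
      ultimately show "\<exists>W. openin T W \<and> x \<in> W \<and> W \<subseteq> O'" by blast
    qed
  qed
  ultimately show ?thesis using p unfolding p_normed_def by blast
qed

section \<open>Consequences of a p-norm\<close>

text \<open>The balls of radius \<open>inverse (real (Suc n))\<close> form a countable neighbourhood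
  base at \<open>x\<close>, and a point of \<open>A\<close> is chosen from each.\<close>

lemma frechet_urysohn_if_p_normed:
  assumes "p_normed smul T"
  shows "frechet_urysohn T"
proof -
  obtain p N where "is_p_norm smul p N" and gen: "p_norm_generates N T"
    using assms unfolding p_normed_def by blast
  then have N: "\<And>x. N x = 0 \<longleftrightarrow> x = 0" "\<And>x y. N (x + y) \<le> N x + N y"
    unfolding is_p_norm_def by auto
  show ?thesis
    unfolding frechet_urysohn_def
  proof (intro allI impI)
    fix A x assume x: "x \<in> T closure_of A"
    have ball: "openin T {y. N (y - x) < r}" for r
      using openin_p_norm_ball[OF gen N(2)] .
    have "\<exists>y\<in>A. N (y - x) < inverse (real (Suc n))" for n
    proof -
      have "x \<in> {y. N (y - x) < inverse (real (Suc n))}" using N(1)[of 0] by simp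
      with x ball[of "inverse (real (Suc n))"]
      have "\<exists>y. y \<in> A \<and> y \<in> {y. N (y - x) < inverse (real (Suc n))}"
        unfolding in_closure_of by meson
      then show ?thesis by blast
    qed
    then obtain s where s: "\<And>n. s n \<in> A" "\<And>n. N (s n - x) < inverse (real (Suc n))" by metis
    have "limitin T s x sequentially"
      unfolding limitin_sequentially
    proof (intro conjI allI impI)
      fix O' assume "openin T O' \<and> x \<in> O'"
      then obtain r where r: "r > 0" "{y. N (y - x) < r} \<subseteq> O'"
        using gen unfolding p_norm_generates_def by blast
      obtain M where M: "inverse (real (Suc M)) < r" using reals_Archimedean r by blast
      have "s n \<in> O'" if "n \<ge> M" for n
      proof -
        have "inverse (real (Suc n)) \<le> inverse (real (Suc M))"
          using that by (simp add: le_imp_inverse_le)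
        then have "N (s n - x) < r" using s(2)[of n] M by linarith
        then show ?thesis using r(2) by blast
      qed
      then show "\<exists>M. \<forall>n\<ge>M. s n \<in> O'" by blast
    qed simp
    then show "\<exists>s. (\<forall>n. s n \<in> A) \<and> limitin T s x sequentially" using s(1) by blast
  qed
qed

text \<open>The balls of integer radius are a fundamental sequence, because scaling by
  \<open>c\<close> multiplies \<open>N\<close> by \<open>norm c powr p\<close>.\<close>

lemma fundamental_bounded_seq_if_p_normed:
  assumes "p_normed smul T"
  shows "has_fundamental_bounded_seq smul T"
proof -
  obtain p N where p: "0 < p" "p \<le> 1" and "is_p_norm smul p N" and gen: "p_norm_generates N T"
    using assms unfolding p_normed_def by blast
  then have N: "\<And>x. N x \<ge> 0" "\<And>x. N x = 0 \<longleftrightarrow> x = 0" "\<And>x y. N (x + y) \<le> N x + N y"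
    "\<And>c x. N (smul c x) = norm c powr p * N x"
    unfolding is_p_norm_def by auto
  have bdd: "tvs_bounded smul T {x. N x \<le> real n}" for n
    unfolding bounded_iff
  proof (intro allI impI)
    fix U assume "openin T U \<and> 0 \<in> U"
    then obtain r where r: "r > 0" "{y. N (y - 0) < r} \<subseteq> U"
      using gen unfolding p_norm_generates_def by blast
    \<comment> \<open>Chosen so that \<open>s powr p\<close> exceeds \<open>real n / r\<close>; the
      added 1 keeps \<open>s\<close> positive when \<open>n = 0\<close>.\<close>
    define s where "s = (real n / r + 1) powr (1 / p)"
    have "real n / r + 1 > 0" using r(1) by (simp add: add_nonneg_pos)
    then have s: "s > 0" "s powr p = real n / r + 1"
      unfolding s_def using p by (auto simp: powr_powr)
    have "smul (inverse t) x \<in> U" if t: "norm t > s" and x: "N x \<le> real n" for t x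
    proof -
      have "real n / r < norm t powr p"
        using powr_mono2[of p s "norm t"] t s p by simp
      then have "real n < r * norm t powr p" using r(1) by (simp add: field_simps)
      with x have "N x < r * norm t powr p" by simp
      moreover have "norm t powr p > 0" using t s by auto
      ultimately have "N (smul (inverse t) x) < r"
        unfolding N(4) by (simp add: norm_divide powr_divide field_simps)
      then show ?thesis using r(2) by auto
    qed
    then show "\<exists>s>0. \<forall>t. norm t > s \<longrightarrow> (\<forall>x\<in>{x. N x \<le> real n}. smul (inverse t) x \<in> U)"
      using s(1) by blast
  qed
  have "\<exists>n. B \<subseteq> {x. N x \<le> real n}" if B: "tvs_bounded smul T B" for B
  proof -
    have "openin T {y. N y < 1}"
      using openin_p_norm_ball[OF gen N(3), of 0 1] by simp
    moreover have "0 \<in> {y. N y < 1}" using N(2)[of 0] by simp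
    ultimately obtain s where s: "s > 0"
        "\<And>t x. norm t > s \<Longrightarrow> x \<in> B \<Longrightarrow> smul (inverse t) x \<in> {y. N y < 1}"
      using boundedE[OF B] by blast
    \<comment> \<open>A single \<open>t\<close> scales \<open>B\<close> into the unit ball, so
      \<open>norm t powr p\<close> bounds \<open>N\<close> on \<open>B\<close>.\<close>
    define t where "t = (of_real (s + 1) :: 'k)"
    have t: "norm t > s" unfolding t_def norm_of_real using s(1) by simp
    have tp: "norm t powr p > 0" using t s by auto
    obtain n where n: "norm t powr p \<le> real n" using real_arch_simple by blast
    have "N x \<le> real n" if "x \<in> B" for x
    proof -
      have "N (smul (inverse t) x) < 1" using s(2)[OF t that] by simp
      then have "N x < norm t powr p"
        using tp unfolding N(4) by (simp add: norm_divide powr_divide field_simps)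
      then show ?thesis using n by simp
    qed
    then show ?thesis by blast
  qed
  then show ?thesis
    using bdd unfolding has_fundamental_bounded_seq_def
    by (intro exI[of _ "\<lambda>n. {x. N x \<le> real n}"]) blast
qed

theorem p_normed_iff:
  "p_normed smul T \<longleftrightarrow> frechet_urysohn T \<and> has_fundamental_bounded_seq smul T"
  using frechet_urysohn_if_p_normed fundamental_bounded_seq_if_p_normed
    bounded_nhd_if_frechet_urysohn p_normed_if_bounded_nhd by metis

end

text \<open>Both conjuncts are instances of \<open>p_normed_iff\<close>, which holds over every
  \<open>real_normed_field\<close>.\<close>

theorem mainTheorem6:
  shows "(\<forall>(smul :: real \<Rightarrow> 'a::ab_group_add \<Rightarrow> 'a) T. tvs smul T \<longrightarrow>
            (p_normed smul T \<longleftrightarrow> frechet_urysohn T \<and> has_fundamental_bounded_seq smul T))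
       \<and> (\<forall>(smul :: complex \<Rightarrow> 'b::ab_group_add \<Rightarrow> 'b) T. tvs smul T \<longrightarrow>
            (p_normed smul T \<longleftrightarrow> frechet_urysohn T \<and> has_fundamental_bounded_seq smul T))"
  by (simp add: tvs_iff_topological_vs topological_vs.p_normed_iff)

end
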